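(* Let $S$ be a simple extension of an infinite field $k$ of characteristic different from $2$, and let $c\in S^*$. Then the set $V_c=\{b\in S^*\mid cb^2\text{ is a primitive element of }S/k\}$ is non-empty and open in $S^*$.
   Context: A $k$-algebra $S$ is a simple extension of degree $n$ of the field $k$ if there is $c\in S^*$ (a primitive element) such that $1,c,\dots,c^{n-1}$ is a $k$-basis of $S$. $S$ is identified with $\mathbb{A}^n(k)$ via a $k$-basis and given the Zariski topology; $S^*$ carries the subspace topology. *)

theory Defs
  imports Main
begin

text \<open>A k-algebra structure on a (unital, possibly noncommutative) ring S is a ring
homomorphism from k into the centre of S.\<close>
definition k_algebra :: "('k::field \<Rightarrow> 's::ring_1) \<Rightarrow> bool" where
  "k_algebra \<phi> \<longleftrightarrow> \<phi> 1 = 1 \<and> (\<forall>a b. \<phi> (a + b) = \<phi> a + \<phi> b)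
     \<and> (\<forall>a b. \<phi> (a * b) = \<phi> a * \<phi> b) \<and> (\<forall>a s. \<phi> a * s = s * \<phi> a)"

text \<open>Units S^* of S.\<close>
definition units_of_ring :: "'s::ring_1 set" where
  "units_of_ring = {s. \<exists>t. s * t = 1 \<and> t * s = 1}"

text \<open>e 0, ..., e (n-1) is a k-basis of S (scalar multiplication a.s = \<phi> a * s).\<close>
definition is_k_basis :: "('k::field \<Rightarrow> 's::ring_1) \<Rightarrow> nat \<Rightarrow> (nat \<Rightarrow> 's) \<Rightarrow> bool" where
  "is_k_basis \<phi> n e \<longleftrightarrow>
     (\<forall>s. \<exists>!a::nat \<Rightarrow> 'k. (\<forall>i\<ge>n. a i = 0) \<and> s = (\<Sum>i<n. \<phi> (a i) * e i))"

text \<open>Coordinates of s with respect to the basis e (a vector in k^n, zero beyond n).\<close>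
definition coords :: "('k::field \<Rightarrow> 's::ring_1) \<Rightarrow> nat \<Rightarrow> (nat \<Rightarrow> 's) \<Rightarrow> 's \<Rightarrow> (nat \<Rightarrow> 'k)" where
  "coords \<phi> n e s = (THE a. (\<forall>i\<ge>n. a i = 0) \<and> s = (\<Sum>i<n. \<phi> (a i) * e i))"

text \<open>c is a primitive element of S/k of degree n: c is a unit and 1, c, ..., c^(n-1)
  is a k-basis of S.\<close>
definition primitive_element :: "('k::field \<Rightarrow> 's::ring_1) \<Rightarrow> nat \<Rightarrow> 's \<Rightarrow> bool" where
  "primitive_element \<phi> n c \<longleftrightarrow> c \<in> units_of_ring \<and> is_k_basis \<phi> n (\<lambda>i. c ^ i)"

text \<open>S is a simple extension of degree n of k.\<close>
definition simple_extension :: "('k::field \<Rightarrow> 's::ring_1) \<Rightarrow> nat \<Rightarrow> bool" where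
  "simple_extension \<phi> n \<longleftrightarrow> k_algebra \<phi> \<and> (\<exists>c. primitive_element \<phi> n c)"

text \<open>Polynomial functions k^n \<rightarrow> k (in the variables x_0, ..., x_(n-1)).\<close>
inductive_set poly_funs :: "nat \<Rightarrow> ((nat \<Rightarrow> 'k::comm_ring_1) \<Rightarrow> 'k) set" for n :: nat where
  const: "(\<lambda>x. a) \<in> poly_funs n"
| var: "i < n \<Longrightarrow> (\<lambda>x. x i) \<in> poly_funs n"
| add: "p \<in> poly_funs n \<Longrightarrow> q \<in> poly_funs n \<Longrightarrow> (\<lambda>x. p x + q x) \<in> poly_funs n"
| mult: "p \<in> poly_funs n \<Longrightarrow> q \<in> poly_funs n \<Longrightarrow> (\<lambda>x. p x * q x) \<in> poly_funs n"

text \<open>Zariski-closed subsets of S, S being identified with k^n via the basis e.\<close>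
definition zariski_closed :: "('k::field \<Rightarrow> 's::ring_1) \<Rightarrow> nat \<Rightarrow> (nat \<Rightarrow> 's) \<Rightarrow> 's set \<Rightarrow> bool" where
  "zariski_closed \<phi> n e Z \<longleftrightarrow>
     (\<exists>P \<subseteq> poly_funs n. Z = {s. \<forall>p\<in>P. p (coords \<phi> n e s) = 0})"

definition zariski_open :: "('k::field \<Rightarrow> 's::ring_1) \<Rightarrow> nat \<Rightarrow> (nat \<Rightarrow> 's) \<Rightarrow> 's set \<Rightarrow> bool" where
  "zariski_open \<phi> n e U \<longleftrightarrow> zariski_closed \<phi> n e (- U)"

text \<open>Open in S^* for the subspace topology.\<close>
definition zariski_open_in_units :: "('k::field \<Rightarrow> 's::ring_1) \<Rightarrow> nat \<Rightarrow> (nat \<Rightarrow> 's) \<Rightarrow> 's set \<Rightarrow> bool" where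
  "zariski_open_in_units \<phi> n e V \<longleftrightarrow>
     (\<exists>U. zariski_open \<phi> n e U \<and> V = U \<inter> units_of_ring)"

end

(*
  A primitive element x of S/k is a point where the polynomial function N(x) * D(x) does not
  vanish, N being the norm of S/k and D the determinant of 1, x, ..., x^(n-1) in the basis e.
  Hence V_c is open: inside S^* it is cut out by D(c b^2) \<noteq> 0.

  For non-emptiness it suffices that the scaled squares c b^2 are Zariski dense. As 2 is
  invertible, c (1 + t w)^2 = c + t s + t^2 c w^2 for w = s / (2 c), so through c passes a curve
  of scaled squares with any prescribed tangent s. A polynomial p vanishing on all these curves
  vanishes everywhere: by induction on j, the t^j-coefficient of p(c + t s) vanishes for every s,
  because p(c + t (s + t s')) / t^j is a polynomial in t vanishing for t \<noteq> 0, hence at t = 0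
  as k is infinite.
*)
theory Submission
  imports Defs "HOL-Computational_Algebra.Polynomial" "Jordan_Normal_Form.Determinant"
begin

section \<open>Polynomial functions along lines and curves\<close>

lemma poly_funs_sum:
  assumes "\<And>a. a \<in> A \<Longrightarrow> f a \<in> poly_funs n"
  shows "(\<lambda>x. \<Sum>a\<in>A. f a x) \<in> poly_funs n"
  using assms
proof (induction A rule: infinite_finite_induct)
  case (insert a A)
  then show ?case using poly_funs.add[of "f a" n "\<lambda>x. \<Sum>a\<in>A. f a x"] by simp
qed (auto intro: poly_funs.const)

lemma poly_funs_prod:
  assumes "\<And>a. a \<in> A \<Longrightarrow> f a \<in> poly_funs n"
  shows "(\<lambda>x. \<Prod>a\<in>A. f a x) \<in> poly_funs n"
  using assms
proof (induction A rule: infinite_finite_induct)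
  case (insert a A)
  then show ?case using poly_funs.mult[of "f a" n "\<lambda>x. \<Prod>a\<in>A. f a x"] by simp
qed (auto intro: poly_funs.const)

lemma poly_funs_det:
  assumes "\<And>i j. (\<lambda>x. F x i j) \<in> poly_funs n"
  shows "(\<lambda>x. det (mat m m (\<lambda>(i, j). F x i j))) \<in> poly_funs n"
  unfolding det_def by (auto intro!: poly_funs_sum poly_funs_prod poly_funs.mult poly_funs.const assms)

lemma poly_funs_along_lines:
  fixes p :: "(nat \<Rightarrow> 'k::comm_ring_1) \<Rightarrow> 'k"
  assumes "p \<in> poly_funs n"
  shows "\<exists>P d. (\<forall>i. (\<lambda>v. coeff (P v) i) \<in> poly_funs n) \<and> (\<forall>v. degree (P v) \<le> d)
           \<and> (\<forall>t v. p (\<lambda>i. x i + t * v i) = poly (P v) t)"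
  using assms
proof (induction rule: poly_funs.induct)
  case (const a)
  show ?case
    by (intro exI[of _ "\<lambda>v. [:a:]"] exI[of _ 0])
       (auto simp: coeff_pCons split: nat.split intro: poly_funs.const)
next
  case (var j)
  have "(\<lambda>v. coeff [:x j, v j:] i) \<in> poly_funs n" for i
  proof (cases i)
    case (Suc k)
    then show ?thesis using var by (cases k) (auto intro: poly_funs.const poly_funs.var)
  qed (auto intro: poly_funs.const)
  then show ?case
    by (intro exI[of _ "\<lambda>v. [:x j, v j:]"] exI[of _ 1]) (auto simp: algebra_simps)
next
  case (add p q)
  then obtain P d Q d' where
    P: "\<forall>i. (\<lambda>v. coeff (P v) i) \<in> poly_funs n" "\<forall>v. degree (P v) \<le> d"
       "\<forall>t v. p (\<lambda>i. x i + t * v i) = poly (P v) t" and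
    Q: "\<forall>i. (\<lambda>v. coeff (Q v) i) \<in> poly_funs n" "\<forall>v. degree (Q v) \<le> d'"
       "\<forall>t v. q (\<lambda>i. x i + t * v i) = poly (Q v) t" by blast
  have "(\<lambda>v. coeff (P v + Q v) i) \<in> poly_funs n" for i
    using P(1) Q(1) by (simp add: poly_funs.add)
  moreover have "degree (P v + Q v) \<le> max d d'" for v
    using P(2) Q(2) degree_add_le by (metis max.coboundedI1 max.coboundedI2)
  ultimately show ?case
    using P(3) Q(3) by (intro exI[of _ "\<lambda>v. P v + Q v"] exI[of _ "max d d'"]) simp
next
  case (mult p q)
  then obtain P d Q d' where
    P: "\<forall>i. (\<lambda>v. coeff (P v) i) \<in> poly_funs n" "\<forall>v. degree (P v) \<le> d"
       "\<forall>t v. p (\<lambda>i. x i + t * v i) = poly (P v) t" and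
    Q: "\<forall>i. (\<lambda>v. coeff (Q v) i) \<in> poly_funs n" "\<forall>v. degree (Q v) \<le> d'"
       "\<forall>t v. q (\<lambda>i. x i + t * v i) = poly (Q v) t" by blast
  have "(\<lambda>v. coeff (P v * Q v) i) \<in> poly_funs n" for i
    using P(1) Q(1) by (simp add: coeff_mult poly_funs_sum poly_funs.mult)
  moreover have "degree (P v * Q v) \<le> d + d'" for v
    using P(2) Q(2) degree_mult_le by (metis add_mono order_trans)
  ultimately show ?case
    using P(3) Q(3) by (intro exI[of _ "\<lambda>v. P v * Q v"] exI[of _ "d + d'"]) simp
qed

lemma poly_eq_0_if_cofinite_roots:
  fixes q :: "'k::idom poly"
  assumes "infinite (UNIV :: 'k set)" "finite F" "\<And>t. t \<notin> F \<Longrightarrow> poly q t = 0"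
  shows "q = 0"
proof (rule ccontr)
  assume "q \<noteq> 0"
  then have "finite {t. poly q t = 0}" by (rule poly_roots_finite)
  moreover have "- F \<subseteq> {t. poly q t = 0}" using assms(3) by auto
  ultimately show False
    using assms(1,2) by (metis Compl_eq_Diff_UNIV finite_Diff2 finite_subset)
qed

lemma coeff_vanishes_along_curve:
  fixes P :: "(nat \<Rightarrow> 'k::idom) \<Rightarrow> 'k poly"
  assumes inf: "infinite (UNIV :: 'k set)"
    and coeff_P: "\<And>m. (\<lambda>v. coeff (P v) m) \<in> poly_funs n" and deg: "\<And>v. degree (P v) \<le> d"
    and curve_zero: "\<And>t. poly (P (\<lambda>i. u i + t * u' i)) t = 0"
    and low: "\<And>m t. m < j \<Longrightarrow> coeff (P (\<lambda>i. u i + t * u' i)) m = 0"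
  shows "coeff (P u) j = 0"
proof (cases "j \<le> d")
  case True
  define \<gamma> where "\<gamma> t = (\<lambda>i. u i + t * u' i)" for t
  have "\<exists>Q. \<forall>t. coeff (P (\<gamma> t)) m = poly Q t" for m
    using poly_funs_along_lines[OF coeff_P[of m], of u] unfolding \<gamma>_def by blast
  then obtain Q where Q: "\<And>m t. coeff (P (\<gamma> t)) m = poly (Q m) t" by metis
  define G where "G = (\<Sum>m\<in>{j..d}. Q m * monom 1 (m - j))"
  have "t ^ j * poly G t = 0" for t
  proof -
    have "t ^ j * poly G t = (\<Sum>m\<in>{j..d}. poly (Q m) t * (t ^ j * t ^ (m - j)))"
      by (simp add: G_def poly_sum poly_monom sum_distrib_left mult_ac)
    also have "\<dots> = (\<Sum>m\<in>{j..d}. coeff (P (\<gamma> t)) m * t ^ m)"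
      by (intro sum.cong) (auto simp: Q simp flip: power_add)
    also have "\<dots> = (\<Sum>m\<le>d. coeff (P (\<gamma> t)) m * t ^ m)"
      by (rule sum.mono_neutral_left) (auto simp: low \<gamma>_def)
    also have "\<dots> = poly (P (\<gamma> t)) t"
      using arg_cong[OF poly_as_sum_of_monoms'[OF deg[of "\<gamma> t"]], of "\<lambda>q. poly q t"]
      by (simp add: poly_sum poly_monom)
    finally show ?thesis using curve_zero by (simp add: \<gamma>_def)
  qed
  then have "G = 0"
    by (intro poly_eq_0_if_cofinite_roots[OF inf, of "{0}"]) auto
  have "poly G 0 = (\<Sum>m\<in>{j..d}. poly (Q m) 0 * 0 ^ (m - j))"
    by (simp add: G_def poly_sum poly_monom)
  also have "\<dots> = (\<Sum>m\<in>{j..d}. if m = j then poly (Q m) 0 else 0)"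
    by (intro sum.cong) auto
  also have "\<dots> = coeff (P u) j"
    using True by (simp add: Q[symmetric] \<gamma>_def)
  finally show ?thesis using \<open>G = 0\<close> by simp
next
  case False
  then show ?thesis using deg[of u] by (simp add: coeff_eq_0)
qed

lemma poly_funs_vanish_by_tangent_curves:
  fixes p :: "(nat \<Rightarrow> 'k::idom) \<Rightarrow> 'k"
  assumes inf: "infinite (UNIV :: 'k set)" and p: "p \<in> poly_funs n"
    and tangent: "\<And>u. u \<in> Dir \<Longrightarrow> \<exists>u'. (\<forall>t. (\<lambda>i. u i + t * u' i) \<in> Dir)
                    \<and> (\<forall>t. p (\<lambda>i. x i + t * (u i + t * u' i)) = 0)"
    and "v \<in> Dir"
  shows "p (\<lambda>i. x i + v i) = 0"
proof -
  obtain P d where coeff_P: "\<And>m. (\<lambda>v. coeff (P v) m) \<in> poly_funs n"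
    and deg: "\<And>v. degree (P v) \<le> d" and P: "\<And>t v. p (\<lambda>i. x i + t * v i) = poly (P v) t"
    using poly_funs_along_lines[OF p, of x] by blast
  have "\<forall>u\<in>Dir. coeff (P u) j = 0" for j
  proof (induction j rule: less_induct)
    case (less j)
    show ?case
    proof
      fix u assume "u \<in> Dir"
      then obtain u' where curve_in: "\<And>t. (\<lambda>i. u i + t * u' i) \<in> Dir"
        and curve_zero: "\<And>t. p (\<lambda>i. x i + t * (u i + t * u' i)) = 0"
        using tangent by blast
      show "coeff (P u) j = 0"
      proof (rule coeff_vanishes_along_curve[OF inf coeff_P deg])
        show "poly (P (\<lambda>i. u i + t * u' i)) t = 0" for t
          using curve_zero[of t] by (simp add: P)
        show "coeff (P (\<lambda>i. u i + t * u' i)) m = 0" if "m < j" for m t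
          using less.IH[OF that] curve_in by blast
      qed
    qed
  qed
  then have "P v = 0" using \<open>v \<in> Dir\<close> by (simp add: poly_eq_iff)
  then show ?thesis using P[of 1 v] by simp
qed

section \<open>Coordinates with respect to a basis\<close>

definition coord_space :: "nat \<Rightarrow> (nat \<Rightarrow> 'a::zero) set" where
  "coord_space n = {a. \<forall>i\<ge>n. a i = 0}"

lemma bij_betw_vec_coord_space: "bij_betw (vec n) (coord_space n) (carrier_vec n)"
  by (rule bij_betw_byWitness[where f' = "\<lambda>v i. if i < n then v $ i else 0"])
     (auto simp: coord_space_def)

lemma det_ne_0_iff_bij_mult_mat_vec:
  fixes A :: "'a::field mat"
  assumes A: "A \<in> carrier_mat n n"
  shows "det A \<noteq> 0 \<longleftrightarrow> bij_betw ((*\<^sub>v) A) (carrier_vec n) (carrier_vec n)"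
proof
  assume "det A \<noteq> 0"
  then have "\<exists>B\<in>carrier_mat n n. B * A = 1\<^sub>m n \<and> A * B = 1\<^sub>m n"
    using det_non_zero_imp_unit[OF A] unfolding Units_def by (simp add: ring_mat_simps)
  then obtain B where B: "B \<in> carrier_mat n n" "B * A = 1\<^sub>m n" "A * B = 1\<^sub>m n" by blast
  have "B *\<^sub>v (A *\<^sub>v v) = v" "A *\<^sub>v (B *\<^sub>v v) = v" if "v \<in> carrier_vec n" for v
    using assoc_mult_mat_vec[OF B(1) A that] assoc_mult_mat_vec[OF A B(1) that] B(2,3) that
    by simp_all
  then show "bij_betw ((*\<^sub>v) A) (carrier_vec n) (carrier_vec n)"
    using A B(1) by (intro bij_betw_byWitness[where f' = "(*\<^sub>v) B"]) auto
next
  assume bij: "bij_betw ((*\<^sub>v) A) (carrier_vec n) (carrier_vec n)"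
  show "det A \<noteq> 0"
  proof
    assume "det A = 0"
    then obtain v where v: "v \<in> carrier_vec n" "v \<noteq> 0\<^sub>v n" "A *\<^sub>v v = 0\<^sub>v n"
      using det_0_iff_vec_prod_zero_field[OF A] by blast
    have "A *\<^sub>v 0\<^sub>v n = 0\<^sub>v n" using A by (intro eq_vecI) auto
    then show False
      using v inj_onD[OF bij_betw_imp_inj_on[OF bij], of v "0\<^sub>v n"] by simp
  qed
qed

lemma bij_betw_UNIV_iff_ex1: "bij_betw f A UNIV \<longleftrightarrow> (\<forall>b. \<exists>!a. a \<in> A \<and> b = f a)"
proof
  assume bij: "bij_betw f A UNIV"
  show "\<forall>b. \<exists>!a. a \<in> A \<and> b = f a"
  proof
    fix b
    obtain a where "a \<in> A" "b = f a" using bij_betw_imp_surj_on[OF bij] by blast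
    moreover have "a' = a" if "a' \<in> A" "b = f a'" for a'
      using inj_onD[OF bij_betw_imp_inj_on[OF bij]] that \<open>a \<in> A\<close> \<open>b = f a\<close> by metis
    ultimately show "\<exists>!a. a \<in> A \<and> b = f a" by blast
  qed
next
  assume ex1: "\<forall>b. \<exists>!a. a \<in> A \<and> b = f a"
  show "bij_betw f A UNIV"
  proof (rule bij_betw_imageI)
    show "inj_on f A"
    proof (rule inj_onI)
      fix x y assume "x \<in> A" "y \<in> A" "f x = f y"
      then show "x = y" using ex1[rule_format, of "f x"] by blast
    qed
    show "f ` A = UNIV" using ex1 by blast
  qed
qed

lemma is_k_basis_iff_bij:
  "is_k_basis \<phi> n w \<longleftrightarrow> bij_betw (\<lambda>a. \<Sum>i<n. \<phi> (a i) * w i) (coord_space n) UNIV"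
  unfolding is_k_basis_def bij_betw_UNIV_iff_ex1 coord_space_def by simp

lemma zariski_open_nonzero:
  assumes "q \<in> poly_funs n"
  shows "zariski_open \<phi> n e {s. q (coords \<phi> n e s) \<noteq> 0}"
  unfolding zariski_open_def zariski_closed_def using assms by (intro exI[of _ "{q}"]) auto

locale k_algebra_basis =
  fixes \<phi> :: "'k::field \<Rightarrow> 's::ring_1" and n :: nat and e :: "nat \<Rightarrow> 's"
  assumes k_algebra: "k_algebra \<phi>" and basis: "is_k_basis \<phi> n e"
begin

lemma phi_one [simp]: "\<phi> 1 = 1"
  and phi_add [simp]: "\<phi> (a + b) = \<phi> a + \<phi> b"
  and phi_mult: "\<phi> (a * b) = \<phi> a * \<phi> b"
  and phi_commute: "\<phi> a * s = s * \<phi> a"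
  using k_algebra unfolding k_algebra_def by blast+

lemma phi_zero [simp]: "\<phi> 0 = 0"
  using phi_add[of 0 0] by simp

lemma phi_mult_mult: "\<phi> a * x * (\<phi> b * y) = \<phi> (a * b) * (x * y)"
  by (metis mult.assoc phi_commute phi_mult)

abbreviation coord :: "'s \<Rightarrow> nat \<Rightarrow> 'k" where
  "coord \<equiv> coords \<phi> n e"

definition of_coords :: "(nat \<Rightarrow> 'k) \<Rightarrow> 's" where
  "of_coords a = (\<Sum>i<n. \<phi> (a i) * e i)"

lemma bij_of_coords: "bij_betw of_coords (coord_space n) UNIV"
  using basis unfolding is_k_basis_iff_bij of_coords_def .

lemma coords_eq_iff: "a \<in> coord_space n \<Longrightarrow> coord s = a \<longleftrightarrow> of_coords a = s"
proof -
  have ex1: "\<exists>!a. a \<in> coord_space n \<and> s = of_coords a"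
    using bij_of_coords unfolding bij_betw_UNIV_iff_ex1 by blast
  have "coord s = (THE a. a \<in> coord_space n \<and> s = of_coords a)"
    unfolding coords_def of_coords_def coord_space_def by simp
  moreover assume "a \<in> coord_space n"
  ultimately show ?thesis using the1_equality[OF ex1] ex1 by metis
qed

lemma coords_in_coord_space: "coord s \<in> coord_space n"
  and of_coords_coords [simp]: "of_coords (coord s) = s"
proof -
  have "\<exists>!a. a \<in> coord_space n \<and> s = of_coords a"
    using bij_of_coords unfolding bij_betw_UNIV_iff_ex1 by blast
  then obtain a where a: "a \<in> coord_space n" "of_coords a = s" by metis
  then have "coord s = a" using coords_eq_iff by blast
  then show "coord s \<in> coord_space n" "of_coords (coord s) = s" using a by simp_all
qed

lemma coords_of_coords: "a \<in> coord_space n \<Longrightarrow> coord (of_coords a) = a"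
  using coords_eq_iff by blast

lemma of_coords_add: "of_coords (\<lambda>i. a i + b i) = of_coords a + of_coords b"
  by (simp add: of_coords_def distrib_right sum.distrib)

lemma of_coords_scale: "of_coords (\<lambda>i. t * a i) = \<phi> t * of_coords a"
  by (simp add: of_coords_def phi_mult sum_distrib_left mult.assoc)

lemma coords_add: "coord (x + y) = (\<lambda>i. coord x i + coord y i)"
  using coords_in_coord_space[of x] coords_in_coord_space[of y]
  by (subst coords_eq_iff) (auto simp: coord_space_def of_coords_add)

lemma coords_scale: "coord (\<phi> t * x) = (\<lambda>i. t * coord x i)"
  using coords_in_coord_space[of x]
  by (subst coords_eq_iff) (auto simp: coord_space_def of_coords_scale)

lemma coords_sum: "coord (\<Sum>a\<in>A. f a) = (\<lambda>i. \<Sum>a\<in>A. coord (f a) i)"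
proof (induction A rule: infinite_finite_induct)
  case (insert a A)
  then show ?case by (simp add: coords_add)
qed (simp_all add: coords_eq_iff coord_space_def of_coords_def)

lemma coords_mult:
  "coord (x * y) i = (\<Sum>j<n. \<Sum>l<n. coord x j * coord y l * coord (e j * e l) i)"
proof -
  have "x * y = of_coords (coord x) * of_coords (coord y)" by simp
  also have "\<dots> = (\<Sum>j<n. \<Sum>l<n. \<phi> (coord x j * coord y l) * (e j * e l))"
    unfolding of_coords_def sum_product phi_mult_mult ..
  finally show ?thesis by (simp add: coords_sum coords_scale)
qed

definition coord_vec :: "'s \<Rightarrow> 'k vec" where
  "coord_vec s = vec n (coord s)"

definition coord_matrix :: "(nat \<Rightarrow> 's) \<Rightarrow> 'k mat" where
  "coord_matrix w = mat n n (\<lambda>(i, j). coord (w j) i)"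

lemma bij_coord_vec: "bij_betw coord_vec UNIV (carrier_vec n)"
proof -
  have "bij_betw coord UNIV (coord_space n)"
    by (rule bij_betw_byWitness[where f' = of_coords])
       (auto simp: coords_of_coords coords_in_coord_space)
  then show ?thesis
    unfolding coord_vec_def using bij_betw_trans[OF _ bij_betw_vec_coord_space] by (simp add: comp_def)
qed

lemma coord_matrix_mult_vec:
  "coord_matrix w *\<^sub>v vec n a = coord_vec (\<Sum>j<n. \<phi> (a j) * w j)"
  by (rule eq_vecI)
     (auto simp: coord_matrix_def coord_vec_def scalar_prod_def coords_sum coords_scale
        atLeast0LessThan mult.commute)

lemma is_k_basis_iff_det: "is_k_basis \<phi> n w \<longleftrightarrow> det (coord_matrix w) \<noteq> 0"
proof -
  let ?L = "\<lambda>a. \<Sum>j<n. \<phi> (a j) * w j"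
  have "is_k_basis \<phi> n w \<longleftrightarrow> bij_betw (coord_vec \<circ> ?L) (coord_space n) (carrier_vec n)"
    unfolding is_k_basis_iff_bij by (rule bij_betw_comp_iff2[OF bij_coord_vec]) simp
  also have "coord_vec \<circ> ?L = (*\<^sub>v) (coord_matrix w) \<circ> vec n"
    by (simp add: comp_def coord_matrix_mult_vec)
  also have "bij_betw \<dots> (coord_space n) (carrier_vec n)
      \<longleftrightarrow> bij_betw ((*\<^sub>v) (coord_matrix w)) (carrier_vec n) (carrier_vec n)"
    by (rule bij_betw_comp_iff[OF bij_betw_vec_coord_space, symmetric])
  also have "\<dots> \<longleftrightarrow> det (coord_matrix w) \<noteq> 0"
    by (rule det_ne_0_iff_bij_mult_mat_vec[symmetric]) (simp add: coord_matrix_def)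
  finally show ?thesis .
qed

definition poly_map :: "((nat \<Rightarrow> 'k) \<Rightarrow> 's) \<Rightarrow> bool" where
  "poly_map g \<longleftrightarrow> (\<forall>i. (\<lambda>x. coord (g x) i) \<in> poly_funs n)"

lemma poly_map_const: "poly_map (\<lambda>x. s)"
  unfolding poly_map_def by (auto intro: poly_funs.const)

lemma poly_map_of_coords: "poly_map of_coords"
  unfolding poly_map_def
proof
  fix i
  have "coord (of_coords x) = (\<lambda>i. if i < n then x i else 0)" for x
    by (subst coords_eq_iff) (auto simp: coord_space_def of_coords_def)
  then show "(\<lambda>x. coord (of_coords x) i) \<in> poly_funs n"
    by (cases "i < n") (auto intro: poly_funs.const poly_funs.var)
qed

lemma poly_map_mult:
  assumes "poly_map g" "poly_map h"
  shows "poly_map (\<lambda>x. g x * h x)"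
  unfolding poly_map_def
proof
  fix i
  have "(\<lambda>x. coord (g x * h x) i)
      = (\<lambda>x. \<Sum>j<n. \<Sum>l<n. coord (g x) j * coord (h x) l * coord (e j * e l) i)"
    by (rule ext) (rule coords_mult)
  then show "(\<lambda>x. coord (g x * h x) i) \<in> poly_funs n"
    using assms unfolding poly_map_def
    by (simp only:) (intro poly_funs_sum poly_funs.mult poly_funs.const; blast)
qed

lemma poly_map_power: "poly_map g \<Longrightarrow> poly_map (\<lambda>x. g x ^ m)"
  by (induction m) (auto intro: poly_map_const poly_map_mult)

lemma poly_funs_det_coord_matrix:
  "(\<And>j. poly_map (\<lambda>x. w x j)) \<Longrightarrow> (\<lambda>x. det (coord_matrix (w x))) \<in> poly_funs n"
  unfolding coord_matrix_def poly_map_def by (rule poly_funs_det) blast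

end

section \<open>Simple extensions\<close>

locale simple_extension_basis = k_algebra_basis \<phi> n e
  for \<phi> :: "'k::field \<Rightarrow> 's::ring_1" and n e +
  assumes simple: "simple_extension \<phi> n"
begin

lemma mult_commute: "x * y = y * (x :: 's)"
proof -
  obtain c where c: "is_k_basis \<phi> n (\<lambda>i. c ^ i)"
    using simple unfolding simple_extension_def primitive_element_def by blast
  have "\<exists>a. z = (\<Sum>i<n. \<phi> (a i) * c ^ i)" for z
    using c unfolding is_k_basis_def by blast
  then obtain a b where x: "x = (\<Sum>i<n. \<phi> (a i) * c ^ i)"
    and y: "y = (\<Sum>j<n. \<phi> (b j) * c ^ j)" by meson
  have "x * y = (\<Sum>i<n. \<Sum>j<n. \<phi> (a i * b j) * c ^ (i + j))"
    by (simp only: x y sum_product phi_mult_mult power_add)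
  also have "\<dots> = (\<Sum>j<n. \<Sum>i<n. \<phi> (b j * a i) * c ^ (j + i))"
    by (subst sum.swap) (simp only: mult.commute add.commute)
  also have "\<dots> = y * x"
    by (simp only: x y sum_product phi_mult_mult power_add)
  finally show ?thesis .
qed

lemma mult_left_commute: "x * (y * z) = y * (x * (z :: 's))"
  by (simp only: mult.assoc[symmetric] mult_commute[of x y])

lemma units_of_ring_iff: "(x :: 's) \<in> units_of_ring \<longleftrightarrow> (\<exists>t. x * t = 1)"
proof
  assume "\<exists>t. x * t = 1"
  then obtain t where "x * t = 1" by blast
  then have "x * t = 1 \<and> t * x = 1" by (simp add: mult_commute[of t])
  then show "x \<in> units_of_ring" unfolding units_of_ring_def by blast
qed (auto simp: units_of_ring_def)

lemma mult_in_units_iff: "(x :: 's) * y \<in> units_of_ring \<longleftrightarrow> x \<in> units_of_ring \<and> y \<in> units_of_ring"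
proof
  assume "x * y \<in> units_of_ring"
  then obtain t where "x * y * t = 1" unfolding units_of_ring_iff by blast
  then have "x * (y * t) = 1" "y * (x * t) = 1" by (simp_all add: mult.assoc mult_left_commute[of y])
  then show "x \<in> units_of_ring \<and> y \<in> units_of_ring" unfolding units_of_ring_iff by blast
next
  assume "x \<in> units_of_ring \<and> y \<in> units_of_ring"
  then obtain s r where "x * s = 1" "y * r = 1" unfolding units_of_ring_iff by blast
  then have "x * y * (r * s) = 1" by (simp add: mult.assoc flip: mult.assoc[of y r s])
  then show "x * y \<in> units_of_ring" unfolding units_of_ring_iff by blast
qed

lemma bij_mult_iff_unit: "bij ((*) (x :: 's)) \<longleftrightarrow> x \<in> units_of_ring"
proof
  assume "bij ((*) x)"
  then show "x \<in> units_of_ring" unfolding units_of_ring_iff by (metis bij_pointE)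
next
  assume "x \<in> units_of_ring"
  then obtain t where "x * t = 1" "t * x = 1" unfolding units_of_ring_def by blast
  then show "bij ((*) x)"
    by (intro bij_betw_byWitness[where f' = "(*) t"]) (auto simp flip: mult.assoc)
qed

lemma is_k_basis_mult_iff_unit: "is_k_basis \<phi> n (\<lambda>j. x * e j) \<longleftrightarrow> x \<in> units_of_ring"
proof -
  have "(\<lambda>a. \<Sum>j<n. \<phi> (a j) * (x * e j)) = (*) x \<circ> of_coords"
    by (simp add: fun_eq_iff of_coords_def sum_distrib_left mult_left_commute)
  then show ?thesis
    unfolding is_k_basis_iff_bij bij_mult_iff_unit[symmetric]
    using bij_betw_comp_iff[OF bij_of_coords] by metis
qed

definition alg_norm :: "'s \<Rightarrow> 'k" where
  "alg_norm x = det (coord_matrix (\<lambda>j. x * e j))"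

definition powers_det :: "'s \<Rightarrow> 'k" where
  "powers_det x = det (coord_matrix (\<lambda>j. x ^ j))"

lemma unit_iff_alg_norm_ne_0: "x \<in> units_of_ring \<longleftrightarrow> alg_norm x \<noteq> 0"
  unfolding alg_norm_def is_k_basis_iff_det[symmetric] is_k_basis_mult_iff_unit ..

lemma primitive_element_iff_powers_det:
  "primitive_element \<phi> n x \<longleftrightarrow> x \<in> units_of_ring \<and> powers_det x \<noteq> 0"
  unfolding primitive_element_def powers_det_def is_k_basis_iff_det ..

lemma square_expansion:
  "c * (1 + \<phi> t * w) ^ 2 = c + \<phi> t * (c * w + c * w) + \<phi> (t * t) * (c * (w * w))"
proof -
  have "(1 + \<phi> t * w) ^ 2 = 1 + \<phi> t * w + \<phi> t * w + \<phi> t * w * (\<phi> t * w)"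
    by (simp add: power2_eq_square distrib_left distrib_right add.assoc)
  also have "\<phi> t * w * (\<phi> t * w) = \<phi> (t * t) * (w * w)"
    by (rule phi_mult_mult)
  finally show ?thesis
    by (simp add: distrib_left add.assoc mult_left_commute[of c "\<phi> t"]
        mult_left_commute[of c "\<phi> (t * t)"])
qed

lemma twice_mult_half_inverse:
  assumes "c * c' = 1" "(2::'k) \<noteq> 0"
  shows "c * (\<phi> (inverse 2) * (c' * s)) + c * (\<phi> (inverse 2) * (c' * s)) = s"
proof -
  have "c * (\<phi> (inverse 2) * (c' * s)) = \<phi> (inverse 2) * s"
    using assms(1) by (simp add: mult_left_commute flip: mult.assoc)
  moreover have "\<phi> (inverse 2) + \<phi> (inverse 2) = 1"
    using assms(2) by (simp flip: phi_add)
  ultimately show ?thesis by (metis distrib_right mult_1_left)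
qed

lemma poly_funs_vanish_on_scaled_squares:
  assumes inf: "infinite (UNIV :: 'k set)" and two: "(2::'k) \<noteq> 0" and c: "c \<in> units_of_ring"
    and p: "p \<in> poly_funs n" and vanish: "\<And>b. p (coord (c * b ^ 2)) = 0"
  shows "p (coord x) = 0"
proof -
  obtain c' where c': "c * c' = 1" using c units_of_ring_iff by blast
  have "p (\<lambda>i. coord c i + coord (x - c) i) = 0"
  proof (rule poly_funs_vanish_by_tangent_curves[OF inf p])
    fix u assume "u \<in> range coord"
    then obtain s where u: "u = coord s" by blast
    define w where "w = \<phi> (inverse 2) * (c' * s)"
    have s: "c * w + c * w = s" unfolding w_def by (rule twice_mult_half_inverse[OF c' two])
    show "\<exists>u'. (\<forall>t. (\<lambda>i. u i + t * u' i) \<in> range coord)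
              \<and> (\<forall>t. p (\<lambda>i. coord c i + t * (u i + t * u' i)) = 0)"
    proof (intro exI conjI allI)
      fix t
      show "(\<lambda>i. u i + t * coord (c * (w * w)) i) \<in> range coord"
        using u by (auto simp: coords_add coords_scale intro!: range_eqI[of _ _ "s + \<phi> t * (c * (w * w))"])
      have "(\<lambda>i. coord c i + t * (u i + t * coord (c * (w * w)) i)) = coord (c * (1 + \<phi> t * w) ^ 2)"
        unfolding square_expansion s u by (simp add: coords_add coords_scale algebra_simps)
      then show "p (\<lambda>i. coord c i + t * (u i + t * coord (c * (w * w)) i)) = 0"
        using vanish by simp
    qed
  qed simp
  then show ?thesis by (simp flip: coords_add)
qed

lemma exists_unit_primitive_scaled_square:
  assumes inf: "infinite (UNIV :: 'k set)" and two: "(2::'k) \<noteq> 0" and c: "c \<in> units_of_ring"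
  shows "\<exists>b\<in>units_of_ring. primitive_element \<phi> n (c * b ^ 2)"
proof (rule ccontr)
  assume none: "\<not> ?thesis"
  define p where "p x = alg_norm (of_coords x) * powers_det (of_coords x)" for x
  have p: "p \<in> poly_funs n"
    unfolding p_def alg_norm_def powers_det_def
    by (intro poly_funs.mult poly_funs_det_coord_matrix poly_map_mult poly_map_power
        poly_map_of_coords poly_map_const)
  have primitive_iff: "primitive_element \<phi> n x \<longleftrightarrow> p (coord x) \<noteq> 0" for x
    unfolding p_def primitive_element_iff_powers_det unit_iff_alg_norm_ne_0 by simp
  have "\<not> primitive_element \<phi> n (c * b ^ 2)" for b
  proof
    assume "primitive_element \<phi> n (c * b ^ 2)"
    moreover from this have "b \<in> units_of_ring"
      by (simp add: primitive_element_def mult_in_units_iff power2_eq_square)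
    ultimately show False using none by blast
  qed
  then have "p (coord (c * b ^ 2)) = 0" for b using primitive_iff by blast
  then have "p (coord x) = 0" for x
    by (rule poly_funs_vanish_on_scaled_squares[OF inf two c p])
  moreover obtain x where "primitive_element \<phi> n x"
    using simple unfolding simple_extension_def by blast
  ultimately show False using primitive_iff by blast
qed

lemma zariski_open_in_units_primitive_scaled_squares:
  assumes c: "c \<in> units_of_ring"
  shows "zariski_open_in_units \<phi> n e {b \<in> units_of_ring. primitive_element \<phi> n (c * b ^ 2)}"
proof -
  define q where "q x = powers_det (c * of_coords x ^ 2)" for x
  have "q \<in> poly_funs n"
    unfolding q_def powers_det_def
    by (intro poly_funs_det_coord_matrix poly_map_power poly_map_mult poly_map_const poly_map_of_coords)
  moreover have "{b \<in> units_of_ring. primitive_element \<phi> n (c * b ^ 2)}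
      = {s. q (coord s) \<noteq> 0} \<inter> units_of_ring"
    using c by (auto simp: q_def primitive_element_iff_powers_det mult_in_units_iff power2_eq_square)
  ultimately show ?thesis
    unfolding zariski_open_in_units_def using zariski_open_nonzero by blast
qed

end

theorem lemma3p3:
  fixes \<phi> :: "'k::field \<Rightarrow> 's::ring_1" and n :: nat and e :: "nat \<Rightarrow> 's" and c :: 's
  assumes "infinite (UNIV :: 'k set)"
    and "(2::'k) \<noteq> 0"
    and "simple_extension \<phi> n"
    and "is_k_basis \<phi> n e"
    and "c \<in> units_of_ring"
  shows "{b \<in> units_of_ring. primitive_element \<phi> n (c * b ^ 2)} \<noteq> {}
       \<and> zariski_open_in_units \<phi> n e {b \<in> units_of_ring. primitive_element \<phi> n (c * b ^ 2)}"
proof -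
  interpret simple_extension_basis \<phi> n e
    using assms(3,4) by unfold_locales (auto simp: simple_extension_def)
  show ?thesis
    using exists_unit_primitive_scaled_square[OF assms(1,2,5)]
      zariski_open_in_units_primitive_scaled_squares[OF assms(5)] by blast
qed

end
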